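(* Fix integers $t\ge0$ and $\ell=2$. Let $\mathbf{x},\mathbf{y}$ be sets of indeterminates, and for $n\ge0$, $0\le i\le 2$, let $a^{(i)}_n(\mathbf{x})\in\mathbb{R}[\mathbf{x}]$, $b_n(\mathbf{y})\in\mathbb{R}[\mathbf{y}]$ be polynomials with nonnegative coefficients. Let $M=[M_{n,k}]_{n,k\ge0}$ be the weighted lattice path matrix defined in the context. Suppose there exist sequences $(\alpha_n(\mathbf{x}))_n$, $(\beta_n(\mathbf{x}))_n$, $(\lambda_n(\mathbf{x}))_n$, $(\mu_n(\mathbf{x}))_n$ of polynomials with nonnegative coefficients such that $a_n^{(0)}=\alpha_n\lambda_n$ for $n\ge0$, $a_n^{(1)}=\alpha_n\mu_n+\beta_n\lambda_{n-1}$ for $n\ge1$, and $a_n^{(2)}=\beta_n\mu_{n-1}$ for $n\ge2$. Then (i) $M$ is $(\mathbf{x},\mathbf{y})$-totally positive; (ii) if $t\ge1$, then for each $n\ge0$ the Toeplitz matrix $[M_{n,i-j}]_{i,j\ge0}$ of the $n$th row sequence of $M$ is $(\mathbf{x},\mathbf{y})$-totally positive (with $M_{n,k}=0$ for $k<0$).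
   Context: For $n,k\ge0$, $M_{n,k}$ is the sum of the weights of all lattice paths in $\mathbb{N}^2$ from $(0,0)$ to $(k,n)$ using the steps $(0,1)$ and $(1,t+i)$ for $0\le i\le\ell$, where each step $(0,1)$ starting at height $n-1$ gets weight $b_n(\mathbf{y})$, each step $(1,t+i)$ starting at height $n-t-i$ gets weight $a^{(i)}_n(\mathbf{x})$, and the weight of a path is the product of the weights of its steps. For a set of indeterminates $\mathbf{z}$, a matrix with entries in $\mathbb{R}[\mathbf{z}]$ is $\mathbf{z}$-totally positive if all its minors are polynomials with nonnegative coefficients in $\mathbf{z}$. *)

theory Defs
  imports "HOL-Library.Poly_Mapping" "Jordan_Normal_Form.Determinant"
begin

text \<open>Real polynomials in indeterminates from the type \<open>'v\<close> (possibly infinitely many):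
  finitely supported maps from monomials (finitely supported exponent vectors) to coefficients,
  with the convolution product of \<^theory>\<open>HOL-Library.Poly_Mapping\<close>.\<close>

type_synonym 'v rpoly = "('v \<Rightarrow>\<^sub>0 nat) \<Rightarrow>\<^sub>0 real"

definition polys_in :: "'v set \<Rightarrow> 'v rpoly set" where
  "polys_in Z = {p. \<forall>m \<in> Poly_Mapping.keys p. Poly_Mapping.keys m \<subseteq> Z}"

definition nonneg_polys :: "'v set \<Rightarrow> 'v rpoly set" where
  "nonneg_polys Z = {p \<in> polys_in Z. \<forall>m. 0 \<le> Poly_Mapping.lookup p m}"

text \<open>The minor of an infinite matrix with rows \<open>I 0 < \<dots> < I (r - 1)\<close> and columns
  \<open>J 0 < \<dots> < J (r - 1)\<close>. Since the minors of order one are the entries, total positivity also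
  forces the entries to be polynomials in \<open>Z\<close>.\<close>

definition minor :: "(nat \<Rightarrow> nat \<Rightarrow> 'r::comm_ring_1) \<Rightarrow> nat \<Rightarrow> (nat \<Rightarrow> nat) \<Rightarrow> (nat \<Rightarrow> nat) \<Rightarrow> 'r" where
  "minor A r I J = det (mat r r (\<lambda>(p, q). A (I p) (J q)))"

definition totally_positive :: "'v set \<Rightarrow> (nat \<Rightarrow> nat \<Rightarrow> 'v rpoly) \<Rightarrow> bool" where
  "totally_positive Z A \<longleftrightarrow>
     (\<forall>r I J. strict_mono_on {..<r} I \<longrightarrow> strict_mono_on {..<r} J \<longrightarrow>
        minor A r I J \<in> nonneg_polys Z)"

text \<open>A lattice path starting at \<open>(0,0)\<close> is given by the list of its steps, each step being its
  displacement vector.\<close>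

definition steps :: "nat \<Rightarrow> nat \<Rightarrow> (nat \<times> nat) set" where
  "steps t l = insert (0, 1) {(1, t + i) | i. i \<le> l}"

definition lattice_paths :: "nat \<Rightarrow> nat \<Rightarrow> nat \<Rightarrow> nat \<Rightarrow> (nat \<times> nat) list set" where
  "lattice_paths t l k n =
     {ss. set ss \<subseteq> steps t l \<and> sum_list (map fst ss) = k \<and> sum_list (map snd ss) = n}"

text \<open>Weight of the step \<open>s\<close> starting at height \<open>h\<close>, hence ending at height \<open>h + snd s\<close>. The
  subscript of a weight is the height at which the step ends, and \<open>a i n\<close> is the weight
  $a^{(i)}_n$.\<close>

definition step_weight ::
    "nat \<Rightarrow> (nat \<Rightarrow> nat \<Rightarrow> 'r) \<Rightarrow> (nat \<Rightarrow> 'r) \<Rightarrow> nat \<Rightarrow> nat \<times> nat \<Rightarrow> 'r" where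
  "step_weight t a b h s =
     (if s = (0, 1) then b (h + 1) else a (snd s - t) (h + snd s))"

fun path_weight ::
    "nat \<Rightarrow> (nat \<Rightarrow> nat \<Rightarrow> 'r::comm_semiring_1) \<Rightarrow> (nat \<Rightarrow> 'r) \<Rightarrow> nat \<Rightarrow> (nat \<times> nat) list \<Rightarrow> 'r" where
  "path_weight t a b h [] = 1"
| "path_weight t a b h (s # ss) = step_weight t a b h s * path_weight t a b (h + snd s) ss"

definition path_matrix ::
    "nat \<Rightarrow> nat \<Rightarrow> (nat \<Rightarrow> nat \<Rightarrow> 'r::comm_semiring_1) \<Rightarrow> (nat \<Rightarrow> 'r) \<Rightarrow> nat \<Rightarrow> nat \<Rightarrow> 'r" where
  "path_matrix t l a b n k = (\<Sum>ss \<in> lattice_paths t l k n. path_weight t a b 0 ss)"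

text \<open>The sum defining \<^const>\<open>path_matrix\<close> is finite, even for \<open>t = 0\<close>.\<close>

lemma finite_steps: "finite (steps t l)"
proof -
  have "steps t l = insert (0, 1) ((\<lambda>i. (1, t + i)) ` {..l})"
    by (auto simp: steps_def)
  then show ?thesis by simp
qed

lemma finite_lattice_paths: "finite (lattice_paths t l k n)"
proof (rule finite_subset)
  have "length ss \<le> sum_list (map fst ss) + sum_list (map snd ss)"
    if "set ss \<subseteq> steps t l" for ss
    using that by (induction ss) (auto simp: steps_def)
  then show "lattice_paths t l k n \<subseteq> {ss. set ss \<subseteq> steps t l \<and> length ss \<le> k + n}"
    by (auto simp: lattice_paths_def)
  show "finite {ss. set ss \<subseteq> steps t l \<and> length ss \<le> k + n}"
    by (rule finite_lists_length_le[OF finite_steps])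
qed

definition toeplitz :: "(nat \<Rightarrow> 'r::zero) \<Rightarrow> nat \<Rightarrow> nat \<Rightarrow> 'r" where
  "toeplitz c i j = (if j \<le> i then c (i - j) else 0)"

end

theory Submission
  imports Defs
begin

text \<open>Fix a height \<open>n\<close> and let \<open>W\<close> be the matrix whose rows \<open>r \<le> n\<close> are those of \<open>M\<close> and whose row
  \<open>n + s\<close> is row \<open>n\<close> of \<open>M\<close> shifted right by \<open>s\<close> places. Translating each path to end on a vertical
  line, \<open>W\<close> is the path matrix of a planar network in which the paths reaching height \<open>n\<close> may stop
  early. Decomposing paths at their last non-vertical step, one obtains \<open>W\<close> from itself by
  duplicating row \<open>n\<close>, shifting the lower rows by \<open>t\<close>, applying two bidiagonal matrices
  (\<open>\<lambda>, \<mu>\<close> and \<open>\<alpha>, \<beta>\<close>), bordering by a unit column, and adding multiples of rows to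
  the next row (\<open>b\<close>). All these operations preserve total positivity, and the first \<open>K\<close> columns of \<open>W\<close>
  are reached after \<open>K\<close> rounds from the zero matrix. Part (i) follows with \<open>n\<close> large; part (ii) since
  the rows \<open>\<ge> n\<close> of \<open>W\<close> form the transposed Toeplitz matrix.\<close>

section \<open>Polynomials with nonnegative coefficients\<close>

lemma nonneg_polys_zero [simp]: "0 \<in> nonneg_polys Z"
  by (simp add: nonneg_polys_def polys_in_def)

lemma nonneg_polys_one [simp]: "1 \<in> nonneg_polys Z"
  by (simp add: nonneg_polys_def polys_in_def lookup_one when_def)

lemma nonneg_polys_add:
  assumes "p \<in> nonneg_polys Z" "q \<in> nonneg_polys Z"
  shows "p + q \<in> nonneg_polys Z"
  using assms keys_add[of p q]
  by (fastforce simp: nonneg_polys_def polys_in_def lookup_add)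

lemma Sum_any_nonneg:
  fixes f :: "'b \<Rightarrow> 'c::ordered_comm_monoid_add"
  assumes "\<And>x. 0 \<le> f x"
  shows "0 \<le> Sum_any f"
  by (simp add: Sum_any.expand_set assms sum_nonneg)

lemma nonneg_polys_mult:
  assumes "p \<in> nonneg_polys Z" "q \<in> nonneg_polys Z"
  shows "p * q \<in> nonneg_polys Z"
proof -
  have "Poly_Mapping.keys m \<subseteq> Z" if "m \<in> Poly_Mapping.keys (p * q)" for m
  proof -
    from that obtain u v where uv: "m = u + v" "u \<in> Poly_Mapping.keys p" "v \<in> Poly_Mapping.keys q"
      using keys_mult[of p q] by blast
    then have "Poly_Mapping.keys u \<subseteq> Z" "Poly_Mapping.keys v \<subseteq> Z"
      using assms by (auto simp: nonneg_polys_def polys_in_def)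
    then show ?thesis
      using uv(1) keys_add[of u v] by blast
  qed
  moreover have "0 \<le> Poly_Mapping.lookup (p * q) m" for m
    unfolding lookup_mult using assms
    by (intro Sum_any_nonneg mult_nonneg_nonneg) (auto simp: nonneg_polys_def when_def)
  ultimately show ?thesis
    by (simp add: nonneg_polys_def polys_in_def)
qed

lemma nonneg_polys_mono: "Z \<subseteq> Z' \<Longrightarrow> nonneg_polys Z \<subseteq> nonneg_polys Z'"
  by (auto simp: nonneg_polys_def polys_in_def)

section \<open>Operations preserving total positivity\<close>

text \<open>Multilinearity in row \<open>m\<close>: every Leibniz term has exactly one factor from
  that row, and replacing the row leaves the other factors unchanged.\<close>

lemma det_row_combination:
  fixes R :: "nat \<Rightarrow> nat \<Rightarrow> 'a::comm_ring_1"
  assumes m: "m < r" and R: "\<And>q. R m q = c * S q + d * T q"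
  shows "det (mat r r (\<lambda>(p, q). R p q)) =
    c * det (mat r r (\<lambda>(p, q). (R(m := S)) p q)) + d * det (mat r r (\<lambda>(p, q). (R(m := T)) p q))"
proof -
  have det: "det (mat r r (\<lambda>(p, q). F p q)) =
      (\<Sum>\<pi> | \<pi> permutes {0..<r}. signof \<pi> * (F m (\<pi> m) * (\<Prod>i \<in> {0..<r} - {m}. F i (\<pi> i))))"
    for F :: "nat \<Rightarrow> nat \<Rightarrow> 'a"
  proof -
    have "(\<Prod>i = 0..<r. mat r r (\<lambda>(p, q). F p q) $$ (i, \<pi> i)) =
        F m (\<pi> m) * (\<Prod>i \<in> {0..<r} - {m}. F i (\<pi> i))" if "\<pi> permutes {0..<r}" for \<pi>
    proof -
      have "(\<Prod>i = 0..<r. mat r r (\<lambda>(p, q). F p q) $$ (i, \<pi> i)) = (\<Prod>i = 0..<r. F i (\<pi> i))"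
        using permutes_in_image[OF that] by (intro prod.cong) auto
      also have "\<dots> = F m (\<pi> m) * (\<Prod>i \<in> {0..<r} - {m}. F i (\<pi> i))"
        using m by (intro prod.remove) auto
      finally show ?thesis .
    qed
    then show ?thesis
      by (subst det_def'[of _ r]) (auto intro!: sum.cong)
  qed
  have upd: "(\<Prod>i \<in> {0..<r} - {m}. (R(m := U)) i (\<pi> i)) = (\<Prod>i \<in> {0..<r} - {m}. R i (\<pi> i))"
    for U \<pi>
    by (intro prod.cong) auto
  show ?thesis
    by (simp only: det upd R fun_upd_same sum_distrib_left flip: sum.distrib)
      (simp add: algebra_simps)
qed

lemma minor_mono_rows_nonneg:
  assumes X: "totally_positive Z X"
    and H: "\<And>p q. p < q \<Longrightarrow> q < r \<Longrightarrow> H p \<le> H q"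
    and J: "strict_mono_on {..<r} J"
  shows "det (mat r r (\<lambda>(p, q). X (H p) (J q))) \<in> nonneg_polys Z"
proof (cases "strict_mono_on {..<r} H")
  case True
  then show ?thesis
    using X J by (simp add: totally_positive_def minor_def)
next
  case False
  then obtain p q where pq: "p < q" "q < r" "\<not> H p < H q"
    by (auto simp: strict_mono_on_def)
  then have "H p = H q"
    using H[of p q] by simp
  then have "det (mat r r (\<lambda>(p, q). X (H p) (J q))) = 0"
    using pq by (intro det_identical_rows[of _ r p q]) (auto intro!: eq_vecI)
  then show ?thesis
    by simp
qed

text \<open>Expanding a minor of \<open>Y\<close> multilinearly in its rows, the last two hypotheses make every choice
  of rows of \<open>X\<close> weakly increasing, so each term is a minor of \<open>X\<close> or has two equal rows.\<close>

lemma totally_positive_row_combination: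
  assumes X: "totally_positive Z X"
    and Y: "\<And>r k. Y r k = c r * X (f r) k + d r * X (g r) k"
    and cd: "\<And>r. c r \<in> nonneg_polys Z" "\<And>r. d r \<in> nonneg_polys Z"
    and fg: "\<And>r. f r \<le> g r" "\<And>r. g r \<le> f (Suc r)"
  shows "totally_positive Z Y"
  unfolding totally_positive_def minor_def
proof (intro allI impI)
  fix r :: nat and I J :: "nat \<Rightarrow> nat"
  assume I: "strict_mono_on {..<r} I" and J: "strict_mono_on {..<r} J"
  \<comment> \<open>Chaining \<open>g i \<le> f (Suc i) \<le> g (Suc i)\<close> separates the rows
    of \<open>X\<close> available at \<open>i\<close> from those available at any later
    \<open>j\<close>.\<close>
  have step: "g i \<le> f j" if "i < j" for i j
    using that
  proof (induction j rule: less_Suc_induct)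
    case (1 i)
    show ?case by (rule fg)
  next
    case (2 i j k)
    then show ?case using fg(1)[of j] by simp
  qed
  \<comment> \<open>Backward induction on \<open>m\<close>, the number of leading rows already
    replaced by chosen rows of \<open>X\<close>: at \<open>m = r\<close> all choices are made, and
    at \<open>m = 0\<close> this is the minor of \<open>Y\<close>.\<close>
  have "det (mat r r (\<lambda>(p, q). if p < m then X (H p) (J q) else Y (I p) (J q))) \<in> nonneg_polys Z"
    if "m \<le> r" and "\<And>p. p < m \<Longrightarrow> H p = f (I p) \<or> H p = g (I p)" for m and H :: "nat \<Rightarrow> nat"
    using that
  proof (induction "r - m" arbitrary: m H)
    case 0
    then have m: "m = r" by simp
    have "H p \<le> H q" if "p < q" "q < r" for p q
    proof -
      have "I p < I q"
        using I that by (auto simp: strict_mono_on_def)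
      then show ?thesis
        using 0(3)[of p] 0(3)[of q] that m step[of "I p" "I q"] fg(1)[of "I p"] fg(1)[of "I q"]
        by auto
    qed
    then have "det (mat r r (\<lambda>(p, q). X (H p) (J q))) \<in> nonneg_polys Z"
      by (intro minor_mono_rows_nonneg[OF X _ J])
    moreover have "mat r r (\<lambda>(p, q). if p < m then X (H p) (J q) else Y (I p) (J q)) =
        mat r r (\<lambda>(p, q). X (H p) (J q))"
      using m by (intro eq_matI) auto
    ultimately show ?case
      by simp
  next
    case (Suc x)
    then have m: "m < r" and x: "x = r - Suc m" by auto
    let ?R = "\<lambda>H m p q. if p < m then X (H p) (J q) else Y (I p) (J q)"
    have upd: "(?R H m)(m := (\<lambda>q. X h (J q))) = ?R (H(m := h)) (Suc m)" for h
      by (auto simp: fun_eq_iff less_Suc_eq)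
    have IH: "det (mat r r (\<lambda>(p, q). ?R (H(m := h)) (Suc m) p q)) \<in> nonneg_polys Z"
      if "h = f (I m) \<or> h = g (I m)" for h
      using that m Suc.prems by (intro Suc.hyps(1)[OF x]) (auto simp: less_Suc_eq)
    have "det (mat r r (\<lambda>(p, q). ?R H m p q)) =
        c (I m) * det (mat r r (\<lambda>(p, q). ?R (H(m := f (I m))) (Suc m) p q)) +
        d (I m) * det (mat r r (\<lambda>(p, q). ?R (H(m := g (I m))) (Suc m) p q))"
      unfolding upd[symmetric] by (rule det_row_combination[OF m]) (simp add: Y)
    then show ?case
      using IH[of "f (I m)"] IH[of "g (I m)"] cd by (simp add: nonneg_polys_add nonneg_polys_mult)
  qed
  from this[of 0 "\<lambda>_. 0"] show "det (mat r r (\<lambda>(p, q). Y (I p) (J q))) \<in> nonneg_polys Z"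
    by simp
qed

lemma minor_cong:
  assumes "\<And>p q. p < r \<Longrightarrow> q < r \<Longrightarrow> A (I p) (J q) = B (I' p) (J' q)"
  shows "minor A r I J = minor B r I' J'"
  unfolding minor_def using assms by (intro arg_cong[of _ _ det] eq_matI) auto

text \<open>The unit column records the empty path; moving \<open>X\<close> one column to the right
  accounts for the horizontal displacement of a non-vertical step.\<close>

definition border :: "(nat \<Rightarrow> nat \<Rightarrow> 'r::{zero,one}) \<Rightarrow> nat \<Rightarrow> nat \<Rightarrow> 'r" where
  "border X r k = (case k of 0 \<Rightarrow> if r = 0 then 1 else 0 | Suc j \<Rightarrow> X r j)"

text \<open>A minor avoiding column \<open>0\<close> is a minor of \<open>X\<close>. Otherwise its
  first column is zero or the first unit vector, and Laplace expansion leaves \<open>0\<close> or a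
  smaller minor of \<open>X\<close>.\<close>

lemma totally_positive_border:
  assumes X: "totally_positive Z X"
  shows "totally_positive Z (border X)"
  unfolding totally_positive_def
proof (intro allI impI)
  fix r :: nat and I J :: "nat \<Rightarrow> nat"
  assume I: "strict_mono_on {..<r} I" and J: "strict_mono_on {..<r} J"
  show "minor (border X) r I J \<in> nonneg_polys Z"
  proof (cases "r = 0 \<or> J 0 > 0")
    case True
    have J_pos: "J q > 0" if "q < r" for q
      using True that strict_mono_onD[OF J, of 0 q] by (cases "q = 0") auto
    then have "minor (border X) r I J = minor X r I (\<lambda>q. J q - 1)"
      by (intro minor_cong) (fastforce simp: border_def split: nat.split)
    moreover have "strict_mono_on {..<r} (\<lambda>q. J q - 1)"
      using J J_pos by (fastforce simp: strict_mono_on_def intro: diff_less_mono)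
    ultimately show ?thesis
      using X I by (simp add: totally_positive_def)
  next
    case False
    then obtain s where r: "r = Suc s" and J0: "J 0 = 0"
      by (cases r) auto
    let ?A = "mat r r (\<lambda>(p, q). border X (I p) (J q))"
    have I_pos: "I (Suc p) > 0" if "Suc p < r" for p
      using strict_mono_onD[OF I, of 0 "Suc p"] that by simp
    have J_pos: "J (Suc q) > 0" if "Suc q < r" for q
      using strict_mono_onD[OF J, of 0 "Suc q"] that by simp
    have "minor (border X) r I J = (\<Sum>i<r. ?A $$ (i, 0) * cofactor ?A i 0)"
      unfolding minor_def by (rule laplace_expansion_column) (auto simp: r)
    \<comment> \<open>Since \<open>I\<close> increases strictly, only the top selected row can be
      row \<open>0\<close>.\<close>
    also have "\<dots> = (\<Sum>i\<in>{0}. ?A $$ (i, 0) * cofactor ?A i 0)"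
    proof (intro sum.mono_neutral_right ballI)
      fix i assume "i \<in> {..<r} - {0}"
      then show "?A $$ (i, 0) * cofactor ?A i 0 = 0"
        using I_pos[of "i - 1"] by (auto simp: border_def J0)
    qed (auto simp: r)
    also have "\<dots> = (if I 0 = 0 then det (mat_delete ?A 0 0) else 0)"
      by (simp add: r border_def J0 cofactor_def)
    also have "mat_delete ?A 0 0 =
        mat s s (\<lambda>(p, q). X (I (Suc p)) (J (Suc q) - 1))"
      using J_pos
      by (intro eq_matI)
        (fastforce simp: mat_delete_def r border_def split: nat.split, simp_all add: mat_delete_def r)
    also have "det \<dots> = minor X s (\<lambda>p. I (Suc p)) (\<lambda>q. J (Suc q) - 1)"
      by (simp add: minor_def)
    finally have minor: "minor (border X) r I J =
        (if I 0 = 0 then minor X s (\<lambda>p. I (Suc p)) (\<lambda>q. J (Suc q) - 1) else 0)" .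
    have "strict_mono_on {..<s} (\<lambda>p. I (Suc p))"
      using I by (auto simp: strict_mono_on_def r)
    moreover have "strict_mono_on {..<s} (\<lambda>q. J (Suc q) - 1)"
      using J J_pos by (auto simp: strict_mono_on_def r intro!: diff_less_mono Suc_leI)
    ultimately show ?thesis
      using X by (simp add: minor totally_positive_def)
  qed
qed

lemma totally_positive_zero: "totally_positive (Z :: 'a set) (\<lambda>_ _. 0)"
  unfolding totally_positive_def minor_def
proof (intro allI impI)
  fix r
  show "det (mat r r (\<lambda>(p, q). 0 :: 'a rpoly)) \<in> nonneg_polys Z"
  \<comment> \<open>The empty minor is \<open>1\<close>; all others vanish.\<close>
  proof (cases r)
    case (Suc s)
    have "mat r r (\<lambda>(p, q). 0 :: 'a rpoly) = 0\<^sub>m r r"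
      by (intro eq_matI) auto
    then show ?thesis
      using Suc by simp
  qed simp
qed

text \<open>A product of elementary operations performed in the order \<open>1, ..., j\<close>, so
  the row added to row \<open>r\<close> has itself been updated already. This models runs of
  vertical steps of any length.\<close>

fun accumulate :: "(nat \<Rightarrow> 'r::comm_ring_1) \<Rightarrow> nat \<Rightarrow> (nat \<Rightarrow> nat \<Rightarrow> 'r) \<Rightarrow> nat \<Rightarrow> nat \<Rightarrow> 'r" where
  "accumulate b 0 X = X"
| "accumulate b (Suc j) X = (\<lambda>r k. (if r = Suc j then b r else 0) * accumulate b j X (r - 1) k
     + accumulate b j X r k)"

lemma totally_positive_accumulate:
  assumes "totally_positive Z X" and "\<And>n. b n \<in> nonneg_polys Z"
  shows "totally_positive Z (accumulate b j X)"
proof (induction j)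
  case (Suc j)
  show ?case
    \<comment> \<open>Here \<open>g r = r = f (Suc r)\<close>, so the row choices interlace.\<close>
    by (rule totally_positive_row_combination[OF Suc,
          where c = "\<lambda>r. if r = Suc j then b r else 0" and f = "\<lambda>r. r - 1" and d = "\<lambda>_. 1" and g = "\<lambda>r. r"])
      (auto simp: assms)
qed (simp add: assms)

text \<open>Forward substitution: when row \<open>Suc j\<close> is treated, row \<open>j\<close>
  already equals that of \<open>W\<close>, while row \<open>Suc j\<close> is still that of
  \<open>X\<close>.\<close>

lemma accumulate_eq:
  assumes "\<And>r. r \<le> j \<Longrightarrow> W r k = X r k + (if r = 0 then 0 else b r * W (r - 1) k)"
  shows "accumulate b j X r k = (if r \<le> j then W r k else X r k)"
  using assms
proof (induction j arbitrary: r)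
  case (Suc j)
  then have "accumulate b j X r k = (if r \<le> j then W r k else X r k)" for r
    by simp
  then show ?case
    using Suc.prems[of r] by (auto simp: le_Suc_eq)
qed simp

section \<open>The path matrix\<close>

lemma path_weight_snoc:
  "path_weight t a b h (ss @ [s]) =
     path_weight t a b h ss * step_weight t a b (h + sum_list (map snd ss)) s"
  by (induction ss arbitrary: h) (auto simp: algebra_simps)

text \<open>The guard keeps the truncated subtractions exact: a step overshooting the endpoint
  contributes no path.\<close>

definition paths_ending_with :: "nat \<Rightarrow> nat \<Rightarrow> nat \<Rightarrow> nat \<Rightarrow> nat \<times> nat \<Rightarrow> (nat \<times> nat) list set" where
  "paths_ending_with t l k n s =
     (if fst s \<le> k \<and> snd s \<le> n then (\<lambda>ss. ss @ [s]) ` lattice_paths t l (k - fst s) (n - snd s) else {})"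

lemma lattice_paths_snoc:
  "lattice_paths t l k n =
     (if k = 0 \<and> n = 0 then {[]} else {}) \<union> (\<Union>s\<in>steps t l. paths_ending_with t l k n s)"
proof (intro subset_antisym subsetI)
  fix ss assume "ss \<in> lattice_paths t l k n"
  then show "ss \<in> (if k = 0 \<and> n = 0 then {[]} else {}) \<union> (\<Union>s\<in>steps t l. paths_ending_with t l k n s)"
  proof (cases ss rule: rev_cases)
    case (snoc us s)
    with \<open>ss \<in> lattice_paths t l k n\<close> have "ss \<in> paths_ending_with t l k n s" "s \<in> steps t l"
      by (auto simp: lattice_paths_def paths_ending_with_def)
    then show ?thesis by blast
  qed (auto simp: lattice_paths_def)
qed (auto simp: lattice_paths_def paths_ending_with_def split: if_splits)

text \<open>Nonempty paths are classified by their last step \<open>s\<close>; it starts at height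
  \<open>n - snd s\<close> whatever precedes it, so its weight factors out of the sum.\<close>

lemma path_matrix_rec:
  "path_matrix t l a b n k = (if k = 0 \<and> n = 0 then 1 else 0) +
     (\<Sum>s\<in>steps t l. if fst s \<le> k \<and> snd s \<le> n
       then path_matrix t l a b (n - snd s) (k - fst s) * step_weight t a b (n - snd s) s else 0)"
proof -
  have fin: "finite (paths_ending_with t l k n s)" for s
    by (simp add: paths_ending_with_def finite_lattice_paths)
  have end_sum: "sum (path_weight t a b 0) (paths_ending_with t l k n s) =
      (if fst s \<le> k \<and> snd s \<le> n
       then path_matrix t l a b (n - snd s) (k - fst s) * step_weight t a b (n - snd s) s else 0)" for s
  proof -
    have "sum (path_weight t a b 0) ((\<lambda>ss. ss @ [s]) ` lattice_paths t l (k - fst s) (n - snd s)) =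
        (\<Sum>ss\<in>lattice_paths t l (k - fst s) (n - snd s).
          path_weight t a b 0 ss * step_weight t a b (n - snd s) s)"
      by (subst sum.reindex) (auto simp: inj_on_def path_weight_snoc lattice_paths_def intro!: sum.cong)
    then show ?thesis
      by (simp add: paths_ending_with_def path_matrix_def sum_distrib_right)
  qed
  have "path_matrix t l a b n k = sum (path_weight t a b 0) (if k = 0 \<and> n = 0 then {[]} else {}) +
      sum (path_weight t a b 0) (\<Union>s\<in>steps t l. paths_ending_with t l k n s)"
    unfolding path_matrix_def lattice_paths_snoc[of t l k n]
  proof (rule sum.union_disjoint)
    show "finite (\<Union>s\<in>steps t l. paths_ending_with t l k n s)"
      using fin finite_steps by blast
  qed (auto simp: paths_ending_with_def split: if_splits)
  also have "sum (path_weight t a b 0) (\<Union>s\<in>steps t l. paths_ending_with t l k n s) =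
      (\<Sum>s\<in>steps t l. sum (path_weight t a b 0) (paths_ending_with t l k n s))"
    using fin finite_steps
    by (intro sum.UNION_disjoint) (auto simp: paths_ending_with_def split: if_splits)
  finally show ?thesis
    by (simp add: end_sum)
qed

lemma sum_steps:
  "(\<Sum>s\<in>steps t l. F s) = F (0, 1) + (\<Sum>i\<le>l. F (1, t + i))" for F :: "nat \<times> nat \<Rightarrow> 'r::comm_monoid_add"
proof -
  have "steps t l = insert (0, 1) ((\<lambda>i. (1, t + i)) ` {..l})"
    by (auto simp: steps_def)
  then show ?thesis
    by (subst \<open>steps t l = _\<close>, subst sum.insert) (auto simp: sum.reindex inj_on_def)
qed

lemma path_matrix_rec_Suc:
  "path_matrix t l a b n (Suc k) =
     (\<Sum>i\<le>l. if t + i \<le> n then a i n * path_matrix t l a b (n - (t + i)) k else 0) +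
     (if n = 0 then 0 else b n * path_matrix t l a b (n - 1) (Suc k))"
  by (subst path_matrix_rec)
    (auto simp: sum_steps step_weight_def algebra_simps intro!: sum.cong arg_cong2[of _ _ _ _ "(+)"])

lemma path_matrix_rec_0:
  "path_matrix t l a b n 0 = (if n = 0 then 1 else b n * path_matrix t l a b (n - 1) 0)"
  by (subst path_matrix_rec) (auto simp: sum_steps step_weight_def algebra_simps)

section \<open>The extended matrix and the operations generating it\<close>

definition extend_row :: "nat \<Rightarrow> (nat \<Rightarrow> nat \<Rightarrow> 'r::zero) \<Rightarrow> nat \<Rightarrow> nat \<Rightarrow> 'r" where
  "extend_row n M r k = (if r \<le> n then M r k else if r - n \<le> k then M n (k - (r - n)) else 0)"

text \<open>Rows up to \<open>n\<close> look down by \<open>t\<close>, the least rise of a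
  non-vertical step. Each row above \<open>n\<close> takes its predecessor, which the column shift
  in \<open>border\<close> then turns into the next shifted copy of row \<open>n\<close>.\<close>

definition shift_op :: "nat \<Rightarrow> nat \<Rightarrow> (nat \<Rightarrow> nat \<Rightarrow> 'r::comm_ring_1) \<Rightarrow> nat \<Rightarrow> nat \<Rightarrow> 'r" where
  "shift_op t n X r k = (if r < t \<and> r \<le> n then 0 else X (if r \<le> n then r - t else r - 1) k)"

text \<open>Bidiagonal up to row \<open>n\<close> and the identity beyond; the condition
  \<open>1 \<le> r\<close> suppresses the missing predecessor of row \<open>0\<close>.\<close>

definition bidiag_op ::
    "nat \<Rightarrow> (nat \<Rightarrow> 'r) \<Rightarrow> (nat \<Rightarrow> 'r) \<Rightarrow> (nat \<Rightarrow> nat \<Rightarrow> 'r::comm_ring_1) \<Rightarrow> nat \<Rightarrow> nat \<Rightarrow> 'r" where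
  "bidiag_op n u v X r k = (if 1 \<le> r \<and> r \<le> n then v r else 0) * X (r - 1) k
     + (if r \<le> n then u r else 1) * X r k"

lemma totally_positive_shift_op:
  assumes "totally_positive Z X"
  shows "totally_positive Z (shift_op t n X)"
  by (rule totally_positive_row_combination[OF assms,
        where c = "\<lambda>r. if r < t \<and> r \<le> n then 0 else 1" and d = "\<lambda>_. 0"
          and f = "\<lambda>r. if r \<le> n then r - t else r - 1" and g = "\<lambda>r. if r \<le> n then r - t else r - 1"])
    (auto simp: shift_op_def)

lemma totally_positive_bidiag_op:
  assumes "totally_positive Z X" "\<And>r. u r \<in> nonneg_polys Z" "\<And>r. v r \<in> nonneg_polys Z"
  shows "totally_positive Z (bidiag_op n u v X)"
  by (rule totally_positive_row_combination[OF assms(1),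
        where c = "\<lambda>r. if 1 \<le> r \<and> r \<le> n then v r else 0" and f = "\<lambda>r. r - 1"
          and d = "\<lambda>r. if r \<le> n then u r else 1" and g = "\<lambda>r. r"])
    (auto simp: bidiag_op_def assms)

lemma totally_positive_extend_row:
  fixes a :: "nat \<Rightarrow> nat \<Rightarrow> 'v rpoly"
  assumes b: "\<And>n. b n \<in> nonneg_polys Z"
    and nonneg: "\<And>n. \<alpha> n \<in> nonneg_polys Z" "\<And>n. \<beta> n \<in> nonneg_polys Z"
      "\<And>n. lam n \<in> nonneg_polys Z" "\<And>n. \<mu> n \<in> nonneg_polys Z"
    and a0: "\<And>n. a 0 n = \<alpha> n * lam n"
    and a1: "\<And>n. n \<ge> 1 \<Longrightarrow> a 1 n = \<alpha> n * \<mu> n + \<beta> n * lam (n - 1)"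
    and a2: "\<And>n. n \<ge> 2 \<Longrightarrow> a 2 n = \<beta> n * \<mu> (n - 1)"
  shows "totally_positive Z (extend_row n (path_matrix t 2 a b))"
proof -
  let ?M = "path_matrix t 2 a b"
  let ?W = "extend_row n ?M"
  define A where "A X = bidiag_op n \<alpha> \<beta> (bidiag_op n lam \<mu> (shift_op t n X))" for X
  define stage where "stage X = accumulate b n (border (A X))" for X
  have A_cong: "A X r k = A X' r k" if "\<And>r. X r k = X' r k" for X X' r k
    by (simp only: A_def bidiag_op_def shift_op_def that)
  \<comment> \<open>Multiplying the two bidiagonal factors gives, in row \<open>r\<close>, the
    coefficients \<open>\<alpha> r * lam r\<close>,
    \<open>\<alpha> r * \<mu> r + \<beta> r * lam (r - 1)\<close> and
    \<open>\<beta> r * \<mu> (r - 1)\<close>, that is \<open>a 0 r\<close>, \<open>a 1 r\<close>,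
    \<open>a 2 r\<close>. Rows \<open>0\<close> and \<open>1\<close> lack some of these terms and
    are treated separately.\<close>
  have A_low: "A ?W r k = (\<Sum>i\<le>2. if t + i \<le> r then a i r * ?M (r - (t + i)) k else 0)"
    if "r \<le> n" for r k
  proof -
    have V: "shift_op t n ?W r k = (if t \<le> r then ?M (r - t) k else 0)" if "r \<le> n" for r
      using that by (auto simp: shift_op_def extend_row_def)
    have sum2: "(\<Sum>i\<le>2. F i) = F 0 + F 1 + F 2" for F :: "nat \<Rightarrow> 'v rpoly"
      by (simp add: numeral_2_eq_2)
    consider "r = 0" | "r = 1" | "r \<ge> 2" by linarith
    then show ?thesis
    proof cases
      case 1
      then show ?thesis
        by (auto simp: A_def bidiag_op_def V a0 sum2)
    next
      case 2
      then show ?thesis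
        using that a1[of 1]
        by (auto simp: A_def bidiag_op_def V a0 sum2 algebra_simps)
    next
      case 3
      then obtain m where m: "r = Suc (Suc m)"
        by (metis add_2_eq_Suc le_Suc_ex)
      then show ?thesis
        using that a1[of r] a2[of r]
        by (auto simp: A_def bidiag_op_def V a0 sum2 algebra_simps Suc_diff_le)
    qed
  qed
  have A_high: "A ?W r k = ?W (r - 1) k" if "r > n" for r k
    using that by (simp add: A_def bidiag_op_def shift_op_def)
  \<comment> \<open>Each round gains a column: \<open>A\<close> acts within columns and
    \<open>border\<close> moves them right, so column \<open>k\<close> of \<open>stage X\<close>
    depends only on column \<open>k - 1\<close> of \<open>X\<close>, or not on \<open>X\<close> if
    \<open>k = 0\<close>.\<close>
  have stage_W: "stage X r k = ?W r k" if "\<And>r j. j < k \<Longrightarrow> X r j = ?W r j" for X r k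
  proof -
    have border: "border (A X) r k = border (A ?W) r k" for r
      using that A_cong[of X "k - 1" ?W] by (auto simp: border_def split: nat.split)
    have "?W r k = border (A X) r k + (if r = 0 then 0 else b r * ?W (r - 1) k)" if "r \<le> n" for r
    proof (cases k)
      case 0
      then show ?thesis
        using that le_trans[OF diff_le_self that, of 1] path_matrix_rec_0[of t 2 a b r] unfolding border by (simp add: extend_row_def border_def)
    next
      case (Suc j)
      then show ?thesis
        using that le_trans[OF diff_le_self that, of 1] path_matrix_rec_Suc[of t 2 a b r j] unfolding border
        by (simp add: extend_row_def border_def A_low)
    qed
    then have "stage X r k = (if r \<le> n then ?W r k else border (A X) r k)"
      unfolding stage_def by (rule accumulate_eq)
    also have "\<dots> = ?W r k"
    \<comment> \<open>Above row \<open>n\<close> no vertical steps are added; row \<open>r\<close>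
      is row \<open>r - 1\<close> moved right, with \<open>0\<close> in column
      \<open>0\<close>.\<close>
    proof (cases "r \<le> n")
      case False
      then have "border (A ?W) r k = ?W r k"
        by (cases k) (auto simp: border_def A_high extend_row_def Suc_diff_le not_le
            intro!: arg_cong2[of _ _ _ _ ?M])
      then show ?thesis
        by (simp add: border)
    qed simp
    finally show ?thesis .
  qed
  have iter: "totally_positive Z ((stage ^^ K) (\<lambda>_ _. 0)) \<and>
      (\<forall>r k. k < K \<longrightarrow> (stage ^^ K) (\<lambda>_ _. 0) r k = ?W r k)" for K
  proof (induction K)
    case (Suc K)
    then have "totally_positive Z (stage ((stage ^^ K) (\<lambda>_ _. 0)))"
      unfolding stage_def A_def
      by (intro totally_positive_accumulate totally_positive_border totally_positive_bidiag_op
          totally_positive_shift_op b nonneg) auto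
    moreover have "stage ((stage ^^ K) (\<lambda>_ _. 0)) r k = ?W r k" if "k < Suc K" for r k
      using Suc that by (intro stage_W) auto
    ultimately show ?case
      by simp
  qed (simp add: totally_positive_zero)
  show ?thesis
    unfolding totally_positive_def
  proof (intro allI impI)
    fix r :: nat and I J :: "nat \<Rightarrow> nat"
    assume IJ: "strict_mono_on {..<r} I" "strict_mono_on {..<r} J"
    \<comment> \<open>A minor meets finitely many columns; this \<open>K\<close> exceeds every
      selected index.\<close>
    define K where "K = Suc (\<Sum>q<r. J q)"
    have "J q < K" if "q < r" for q
      using that member_le_sum[of q "{..<r}" J] by (simp add: K_def)
    then have "minor ?W r I J = minor ((stage ^^ K) (\<lambda>_ _. 0)) r I J"
      using iter[of K] by (intro minor_cong) auto
    then show "minor ?W r I J \<in> nonneg_polys Z"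
      using iter[of K] IJ by (simp add: totally_positive_def)
  qed
qed

theorem theorem1p5:
  fixes t :: nat
    and X Y :: "'v set"
    and a :: "nat \<Rightarrow> nat \<Rightarrow> 'v rpoly"
    and b :: "nat \<Rightarrow> 'v rpoly"
  assumes a_nonneg: "\<And>i n. i \<le> 2 \<Longrightarrow> a i n \<in> nonneg_polys X"
    and b_nonneg: "\<And>n. b n \<in> nonneg_polys Y"
    and factorization: "\<exists>\<alpha> \<beta> lam \<mu> :: nat \<Rightarrow> 'v rpoly.
      (\<forall>n. \<alpha> n \<in> nonneg_polys X \<and> \<beta> n \<in> nonneg_polys X \<and>
           lam n \<in> nonneg_polys X \<and> \<mu> n \<in> nonneg_polys X) \<and>
      (\<forall>n. a 0 n = \<alpha> n * lam n) \<and>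
      (\<forall>n\<ge>1. a 1 n = \<alpha> n * \<mu> n + \<beta> n * lam (n - 1)) \<and>
      (\<forall>n\<ge>2. a 2 n = \<beta> n * \<mu> (n - 1))"
  shows "totally_positive (X \<union> Y) (path_matrix t 2 a b) \<and>
    (t \<ge> 1 \<longrightarrow> (\<forall>n. totally_positive (X \<union> Y) (toeplitz (path_matrix t 2 a b n))))"
proof -
  let ?M = "path_matrix t 2 a b"
  have XY: "p \<in> nonneg_polys (X \<union> Y)" if "p \<in> nonneg_polys X \<or> p \<in> nonneg_polys Y" for p
    using that nonneg_polys_mono[of X "X \<union> Y"] nonneg_polys_mono[of Y "X \<union> Y"] by blast
  from factorization obtain \<alpha> \<beta> lam \<mu> :: "nat \<Rightarrow> 'v rpoly" where
    nonneg: "\<And>n. \<alpha> n \<in> nonneg_polys X" "\<And>n. \<beta> n \<in> nonneg_polys X"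
      "\<And>n. lam n \<in> nonneg_polys X" "\<And>n. \<mu> n \<in> nonneg_polys X"
    and fact: "\<And>n. a 0 n = \<alpha> n * lam n"
      "\<And>n. n \<ge> 1 \<Longrightarrow> a 1 n = \<alpha> n * \<mu> n + \<beta> n * lam (n - 1)"
      "\<And>n. n \<ge> 2 \<Longrightarrow> a 2 n = \<beta> n * \<mu> (n - 1)"
    by blast
  have W: "totally_positive (X \<union> Y) (extend_row n ?M)" for n
    by (rule totally_positive_extend_row[where \<alpha> = \<alpha> and \<beta> = \<beta> and lam = lam and \<mu> = \<mu>])
      (simp_all add: XY b_nonneg nonneg fact del: One_nat_def)
  have "minor ?M r I J \<in> nonneg_polys (X \<union> Y)"
    if IJ: "strict_mono_on {..<r} I" "strict_mono_on {..<r} J" for r I J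
  proof -
    \<comment> \<open>The sum bounds every selected row index, so the minor lies in the unmodified
      rows of the extended matrix.\<close>
    define n where "n = (\<Sum>p<r. I p)"
    have "I p \<le> n" if "p < r" for p
      using that member_le_sum[of p "{..<r}" I] by (simp add: n_def)
    then have "minor ?M r I J = minor (extend_row n ?M) r I J"
      by (intro minor_cong) (simp add: extend_row_def)
    then show ?thesis
      using W[of n] IJ by (simp add: totally_positive_def)
  qed
  moreover have "minor (toeplitz (?M n)) r I J \<in> nonneg_polys (X \<union> Y)"
    if IJ: "strict_mono_on {..<r} I" "strict_mono_on {..<r} J" for n r I J
  proof -
    have "minor (toeplitz (?M n)) r I J = det (mat r r (\<lambda>(p, q). toeplitz (?M n) (I p) (J q)))"
      by (simp add: minor_def)
    also have "\<dots> = det (transpose_mat (mat r r (\<lambda>(p, q). toeplitz (?M n) (I p) (J q))))"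
      by (rule det_transpose[of _ r, symmetric]) simp
    \<comment> \<open>Row \<open>n + s\<close> of the extended matrix is row \<open>n\<close> of
      \<open>?M\<close> moved right by \<open>s\<close>, hence column \<open>s\<close> of the
      Toeplitz matrix.\<close>
    also have "transpose_mat (mat r r (\<lambda>(p, q). toeplitz (?M n) (I p) (J q))) =
        mat r r (\<lambda>(p, q). extend_row n ?M (n + J p) (I q))"
      by (intro eq_matI) (auto simp: toeplitz_def extend_row_def)
    also have "det \<dots> = minor (extend_row n ?M) r (\<lambda>p. n + J p) I"
      by (simp add: minor_def)
    also have "\<dots> \<in> nonneg_polys (X \<union> Y)"
      using W[of n] IJ by (simp add: totally_positive_def strict_mono_on_def)
    finally show ?thesis .
  qed
  ultimately show ?thesis
    by (simp add: totally_positive_def)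
qed

end
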